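(* Let $G$ be a graph. The following properties are equivalent: (i) $G$ is a $2$-distance graph; (ii) for every edge $v_1v_2\in E(G)$, there exists $v_3\in V(G)$ that is not adjacent in $G$ to $v_1$ and not adjacent in $G$ to $v_2$; (iii) $\mathrm{diam}(G^c)\le 2$, where $G^c$ is the complement of $G$.
   Context: All graphs are finite and simple, but not necessarily connected. For vertices $u,v$ of a graph $X$, $\mathrm{dist}_X(u,v)$ is the length of a shortest $u$-$v$ path in $X$, with $\mathrm{dist}_X(u,v)=0$ iff $u=v$, and $\mathrm{dist}_X(u,v)=\infty$ iff $u$ and $v$ lie in different components of $X$. The diameter is $\mathrm{diam}(X)=\max\{\mathrm{dist}_X(u,v): u,v\in V(X)\}$ (possibly $\infty$). The $2$-distance graph $T_2(X)$ of $X$ is the graph with vertex set $V(X)$ in which $u,v$ are adjacent if and only if $\mathrm{dist}_X(u,v)=2$. A graph $G$ is called a $2$-distance graph if there exists a graph $X$ with $T_2(X)=G$, where equality refers to graph isomorphism. *)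

theory Defs
  imports "Graph_Theory.Graph_Theory" "HOL-Library.Extended_Nat"
begin

text \<open>
  A finite simple graph is a \<open>G :: 'a pair_pre_digraph\<close> with \<open>pair_graph G\<close>: a finite vertex set
  \<open>pverts G\<close> and a symmetric irreflexive adjacency relation \<open>parcs G\<close> on it, so that an edge \<open>uv\<close> is
  represented by the two pairs \<open>(u,v)\<close> and \<open>(v,u)\<close>. The null graph is allowed.
\<close>

text \<open>The infimum of the empty set is \<open>\<infinity>\<close>, which is the value for vertices in different components.\<close>

definition gdist :: "('a,'b) pre_digraph \<Rightarrow> 'a \<Rightarrow> 'a \<Rightarrow> enat" where
  "gdist X u v = (INF p\<in>{p. pre_digraph.apath X u p v}. enat (length p))"

text \<open>A supremum rather than \<open>Max\<close>, so that the null graph gets diameter 0.\<close>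

definition gdiam :: "('a,'b) pre_digraph \<Rightarrow> enat" where
  "gdiam X = (SUP (u,v)\<in>verts X \<times> verts X. gdist X u v)"

definition graph_compl :: "'a pair_pre_digraph \<Rightarrow> 'a pair_pre_digraph" where
  "graph_compl G = \<lparr> pverts = pverts G,
     parcs = {(u,v). u \<in> pverts G \<and> v \<in> pverts G \<and> u \<noteq> v \<and> (u,v) \<notin> parcs G} \<rparr>"

definition T2 :: "'a pair_pre_digraph \<Rightarrow> 'a pair_pre_digraph" where
  "T2 X = \<lparr> pverts = pverts X,
     parcs = {(u,v). u \<in> pverts X \<and> v \<in> pverts X \<and> gdist (with_proj X) u v = 2} \<rparr>"

text \<open>
  The witness \<open>X\<close> has vertices of the same type as \<open>G\<close>; by \<open>two_distance_graphI\<close> below, a witness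
  over any other vertex type would do as well.
\<close>

definition two_distance_graph :: "'a pair_pre_digraph \<Rightarrow> bool" where
  "two_distance_graph G \<longleftrightarrow>
     (\<exists>X :: 'a pair_pre_digraph. pair_graph X \<and> digraph_iso (with_proj (T2 X)) (with_proj G))"


lemma (in fin_digraph) gdist_eq_\<mu>: "ereal_of_enat (gdist G u v) = \<mu> (\<lambda>_. 1) u v"
proof -
  have cost: "awalk_cost (\<lambda>_. 1) p = real (length p)" for p
    by (induct p) auto
  show ?thesis
  proof (cases "u \<rightarrow>\<^sup>* v")
    case False
    then have "{p. apath u p v} = {}"
      by (auto simp: reachable_awalk apath_def)
    then have "gdist G u v = \<infinity>"
      by (simp add: gdist_def top_enat_def)
    with False show ?thesis by (simp add: shortest_path_inf)
  next
    case True
    then obtain p where p: "apath u p v" "\<mu> (\<lambda>_. 1) u v = awalk_cost (\<lambda>_. 1) p"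
      using min_cost_awalk[of u v "\<lambda>_. 1"] by auto
    have "length p \<le> length q" if "apath u q v" for q
    proof -
      have "\<mu> (\<lambda>_. 1) u v \<le> awalk_cost (\<lambda>_. 1) q"
        using that by (intro min_cost_le_walk_cost awalkI_apath)
      then show ?thesis using p by (simp add: cost)
    qed
    then have "gdist G u v = enat (length p)"
      unfolding gdist_def using p(1) by (intro antisym INF_lower INF_greatest) auto
    then show ?thesis using p by (simp add: cost)
  qed
qed

lemma pair_graph_graph_compl: "pair_graph G \<Longrightarrow> pair_graph (graph_compl G)"
proof -
  assume "pair_graph G"
  then interpret pair_graph G .
  have "finite (parcs (graph_compl G))"
    by (rule finite_subset[of _ "pverts G \<times> pverts G"]) (auto simp: graph_compl_def)
  moreover have "(v,u) \<in> parcs G" if "(u,v) \<in> parcs G" for u v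
    using that by (rule arcs_symmetric)
  ultimately show ?thesis
    by unfold_locales (auto simp: graph_compl_def symmetric_def sym_def)
qed

lemma (in wf_digraph) gdist_app_iso_le:
  assumes hom: "digraph_isomorphism hom" and "u \<in> verts G"
  shows "gdist (app_iso hom G) (iso_verts hom u) (iso_verts hom v) \<le> gdist G u v"
  unfolding gdist_def
proof (rule INF_mono)
  fix p assume "p \<in> {p. apath u p v}"
  then have p: "awalk u p v" "distinct (awalk_verts u p)" by (auto simp: apath_def)
  have "inj_on (iso_verts hom) (set (awalk_verts u p))"
    using hom p(1) by (meson awalkE digraph_isomorphism_inj_on_verts inj_on_subset)
  then have "pre_digraph.apath (app_iso hom G) (iso_verts hom u) (map (iso_arcs hom) p) (iso_verts hom v)"
    using p hom
    by (simp add: pre_digraph.apath_def awalk_app_isoI awalk_verts_app_iso_eq distinct_map)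
  then show "\<exists>q\<in>{q. pre_digraph.apath (app_iso hom G) (iso_verts hom u) q (iso_verts hom v)}.
      enat (length q) \<le> enat (length p)"
    by (intro bexI[of _ "map (iso_arcs hom) p"]) auto
qed

lemma (in wf_digraph) gdist_app_iso:
  assumes hom: "digraph_isomorphism hom" and "u \<in> verts G" "v \<in> verts G"
  shows "gdist (app_iso hom G) (iso_verts hom u) (iso_verts hom v) = gdist G u v"
proof (rule antisym)
  interpret H: wf_digraph "app_iso hom G" using hom ..
  show "gdist (app_iso hom G) (iso_verts hom u) (iso_verts hom v) \<le> gdist G u v"
    using assms by (intro gdist_app_iso_le)
  have "gdist (app_iso (inv_iso hom) (app_iso hom G)) (iso_verts (inv_iso hom) (iso_verts hom u))
      (iso_verts (inv_iso hom) (iso_verts hom v))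
    \<le> gdist (app_iso hom G) (iso_verts hom u) (iso_verts hom v)"
    using assms by (intro H.gdist_app_iso_le digraph_isomorphism_invI) auto
  then show "gdist G u v \<le> gdist (app_iso hom G) (iso_verts hom u) (iso_verts hom v)"
    using assms by simp
qed

lemma pair_graph_T2: "pair_graph X \<Longrightarrow> pair_graph (T2 X)"
proof -
  assume "pair_graph X"
  then interpret pair_graph X .
  have fin: "finite (parcs (T2 X))"
    by (rule finite_subset[of _ "pverts X \<times> pverts X"]) (auto simp: T2_def)
  have "gdist X u u = 0" if "u \<in> pverts X" for u
  proof -
    have "gdist X u u \<le> enat (length ([] :: ('a \<times> 'a) list))"
      unfolding gdist_def using that by (intro INF_lower) (simp add: apath_Nil_iff)
    then show ?thesis by (simp flip: zero_enat_def)
  qed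
  then have irr: "gdist X u u \<noteq> 2" if "u \<in> pverts X" for u
    using that by simp
  have swap: "gdist X v u \<le> gdist X u v" for u v
    unfolding gdist_def
  proof (rule INF_mono)
    fix p assume "p \<in> {p. apath u p v}"
    then have p: "awalk u p v" "distinct (awalk_verts u p)" by (auto simp: apath_def)
    have sym: "(y,x) \<in> parcs X" if "(x,y) \<in> parcs X" for x y
      using that by (rule arcs_symmetric)
    from p(1) have "awalk v (rev (map prod.swap p)) u \<and>
        awalk_verts v (rev (map prod.swap p)) = rev (awalk_verts u p)"
    proof (induct p arbitrary: u)
      case Nil
      then show ?case by (auto simp: awalk_Nil_iff)
    next
      case (Cons e p)
      obtain a b where e: "e = (a,b)" by (cases e)
      from Cons.prems have a: "a = u" "(u,b) \<in> parcs X" "awalk b p v"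
        by (auto simp: awalk_Cons_iff e)
      from Cons.hyps[OF a(3)] have IH: "awalk v (rev (map prod.swap p)) b"
          "awalk_verts v (rev (map prod.swap p)) = rev (awalk_verts b p)" by auto
      have step: "awalk b [(b,u)] u"
        using sym[OF a(2)] in_arcsD1[OF sym[OF a(2)]] in_arcsD2[OF sym[OF a(2)]]
        by (auto simp: awalk_simps)
      have "awalk v (rev (map prod.swap p) @ [(b,u)]) u"
        using IH(1) step by (rule awalk_appendI)
      moreover from this IH have "awalk_verts v (rev (map prod.swap p) @ [(b,u)])
          = rev (awalk_verts b p) @ [u]"
        using awalk_verts_append[of v "rev (map prod.swap p)" "[(b,u)]" u] awalk_ends[OF IH(1)]
        by auto
      ultimately show ?case by (simp add: e a)
    qed
    then have "apath v (rev (map prod.swap p)) u" using p(2) by (simp add: apath_def)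
    then show "\<exists>q\<in>{q. apath v q u}. enat (length q) \<le> enat (length p)"
      by (intro bexI[of _ "rev (map prod.swap p)"]) auto
  qed
  have "gdist X v u = gdist X u v" for u v
    using swap[of u v] swap[of v u] by simp
  then show ?thesis
    using fin irr by unfold_locales (auto simp: T2_def symmetric_def sym_def)
qed

lemma two_distance_graphI:
  fixes X :: "'b pair_pre_digraph" and G :: "'a pair_pre_digraph"
  assumes X: "pair_graph X" and iso: "digraph_iso (with_proj (T2 X)) (with_proj G)"
  shows "two_distance_graph G"
proof -
  interpret X: pair_graph X by fact
  interpret T: pair_graph "T2 X" using X by (rule pair_graph_T2)
  from iso obtain f :: "('b, 'b \<times> 'b, 'a, 'a \<times> 'a) digraph_isomorphism"
    where f: "pre_digraph.digraph_isomorphism (with_proj (T2 X)) f"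
    unfolding digraph_iso_def by blast
  define h where "h = iso_verts f"
  have inj: "inj_on h (pverts X)"
    using T.digraph_isomorphism_inj_on_verts[OF f] by (simp add: h_def T2_def)
  define hom :: "('b, 'b \<times> 'b, 'a, 'a \<times> 'a) digraph_isomorphism" where
    "hom = \<lparr> iso_verts = h, iso_arcs = map_prod h h, iso_head = snd, iso_tail = fst \<rparr>"
  have inj_arcs: "inj_on (map_prod h h) A" if "A \<subseteq> pverts X \<times> pverts X" for A
    by (rule inj_on_subset[OF map_prod_inj_on[OF inj inj] that])
  have arcs_sub: "parcs X \<subseteq> pverts X \<times> pverts X"
    using X.in_arcsD1 X.in_arcsD2 by auto
  have homX: "X.digraph_isomorphism hom"
    unfolding X.digraph_isomorphism_def
    using inj inj_arcs[OF arcs_sub] by (auto simp: hom_def intro: X.wf_digraph)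
  define X' where "X' = \<lparr> pverts = h ` pverts X, parcs = map_prod h h ` parcs X \<rparr>"
  have X': "with_proj X' = app_iso hom (with_proj X)"
    by (simp add: X'_def hom_def with_proj_def app_iso_def)
  have "pair_graph X'"
  proof -
    have "h u \<noteq> h v" if "(u,v) \<in> parcs X" for u v
      using that inj arcs_sub X.pair_no_loops[OF that] by (auto dest: inj_onD)
    moreover have "(v,u) \<in> parcs X" if "(u,v) \<in> parcs X" for u v
      using that by (rule X.arcs_symmetric)
    ultimately show ?thesis
      using arcs_sub X.pair_finite_verts X.pair_finite_arcs
      by unfold_locales (auto simp: X'_def symmetric_def intro!: symI)
  qed
  moreover have "digraph_iso (with_proj (T2 X')) (with_proj (T2 X))"
  proof -
    have pvX': "pverts X' = h ` pverts X" by (simp add: X'_def)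
    have d: "gdist (with_proj X') (h u) (h v) = gdist (with_proj X) u v"
      if "u \<in> pverts X" "v \<in> pverts X" for u v
    proof -
      have "gdist (app_iso hom (with_proj X)) (iso_verts hom u) (iso_verts hom v)
          = gdist (with_proj X) u v"
        using that by (intro X.gdist_app_iso homX) simp_all
      then show ?thesis by (simp only: X'[symmetric]) (simp add: hom_def)
    qed
    have "T.digraph_isomorphism hom"
      unfolding T.digraph_isomorphism_def
      using inj inj_arcs[of "parcs (T2 X)"] T.wf_digraph by (auto simp: hom_def T2_def)
    moreover have "with_proj (T2 X') = app_iso hom (with_proj (T2 X))"
    proof -
      have "parcs (T2 X') = map_prod h h ` parcs (T2 X)"
        unfolding set_eq_iff
      proof (intro allI iffI)
        fix e assume "e \<in> parcs (T2 X')"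
        then obtain u v where uv: "u \<in> pverts X" "v \<in> pverts X" "e = (h u, h v)"
            "gdist (with_proj X') (h u) (h v) = 2"
          by (auto simp: T2_def pvX')
        then have "(u,v) \<in> parcs (T2 X)" using d[OF uv(1,2)] by (simp add: T2_def)
        then show "e \<in> map_prod h h ` parcs (T2 X)" using uv(3) by force
      next
        fix e assume "e \<in> map_prod h h ` parcs (T2 X)"
        then obtain u v where uv: "u \<in> pverts X" "v \<in> pverts X" "e = (h u, h v)"
            "gdist (with_proj X) u v = 2"
          by (auto simp: T2_def)
        then show "e \<in> parcs (T2 X')" using d[OF uv(1,2)] by (simp add: T2_def pvX')
      qed
      then show ?thesis
        by (simp add: with_proj_def app_iso_def hom_def) (simp add: T2_def X'_def)
    qed
    ultimately have "digraph_iso (with_proj (T2 X)) (with_proj (T2 X'))"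
      unfolding digraph_iso_def by blast
    then show ?thesis by (rule digraph_iso_swap[OF T.wf_digraph])
  qed
  ultimately show ?thesis
    unfolding two_distance_graph_def using iso digraph_iso_trans by blast
qed

end

theory Submission
  imports Defs
begin

text \<open>
  Distance at most 2 is a local condition: it means equal, adjacent, or having a common neighbour
  (\<open>gdist_le_two_iff\<close>, \<open>gdist_eq_two_iff\<close>). Call the second property the \<^emph>\<open>non-neighbour
  condition\<close>: both ends of each edge avoid a common vertex. A common non-neighbour of two adjacent
  vertices of \<open>G\<close> is the same thing as a common neighbour in the complement, since neither end of
  an edge can itself serve as one. Vertices that are not adjacent in \<open>G\<close> are equal or adjacent in
  the complement. So the non-neighbour condition says exactly that the complement has diameter at
  most 2, and in that case it says moreover that the pairs at distance exactly 2 in the complement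
  are the edges of \<open>G\<close>, that is, \<open>T2 (graph_compl G) = G\<close>.

  Conversely, if \<open>G\<close> is the 2-distance graph of some \<open>X\<close>, then the ends of an edge of \<open>G\<close> have a
  common neighbour in \<open>X\<close>; being at distance 1 from both of them, it is adjacent to neither in \<open>G\<close>.
\<close>

section \<open>Small distances\<close>

text \<open>The infimum that defines the distance is attained, because \<open>enat\<close> is well-ordered.\<close>

lemma gdist_le_iff_apath:
  "gdist X u v \<le> enat k \<longleftrightarrow> (\<exists>p. pre_digraph.apath X u p v \<and> length p \<le> k)"
proof
  assume le: "gdist X u v \<le> enat k"
  let ?S = "(\<lambda>p. enat (length p)) ` {p. pre_digraph.apath X u p v}"
  have "?S \<noteq> {}"
  proof
    assume "?S = {}"
    then have "gdist X u v = \<infinity>"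
      unfolding gdist_def by (simp only: Inf_empty top_enat_def)
    with le show False by simp
  qed
  then have "gdist X u v \<in> ?S"
    unfolding gdist_def by (auto simp: Inf_enat_def intro: LeastI)
  with le show "\<exists>p. pre_digraph.apath X u p v \<and> length p \<le> k"
    by auto
next
  assume "\<exists>p. pre_digraph.apath X u p v \<and> length p \<le> k"
  then show "gdist X u v \<le> enat k"
    unfolding gdist_def by (auto intro!: INF_lower2)
qed

context pair_wf_digraph
begin

lemma gdist_le_one_iff:
  assumes "u \<in> pverts G" "v \<in> pverts G"
  shows "gdist G u v \<le> 1 \<longleftrightarrow> u = v \<or> (u, v) \<in> parcs G"
proof
  assume "gdist G u v \<le> 1"
  then obtain p where p: "apath u p v" "length p \<le> 1"
    using gdist_le_iff_apath[of G u v 1] by (auto simp: one_enat_def)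
  then show "u = v \<or> (u, v) \<in> parcs G"
    by (cases p) (auto simp: apath_def awalk_simps)
next
  assume a: "u = v \<or> (u, v) \<in> parcs G"
  have "\<exists>p. apath u p v \<and> length p \<le> 1"
  proof (cases "u = v")
    case True
    with assms show ?thesis by (intro exI[of _ "[]"]) (simp add: apath_Nil_iff)
  next
    case False
    with a assms show ?thesis
      by (intro exI[of _ "[(u, v)]"]) (auto simp: apath_def awalk_simps)
  qed
  then show "gdist G u v \<le> 1"
    using gdist_le_iff_apath[of G u v 1] by (simp add: one_enat_def)
qed

lemma gdist_le_two_iff:
  assumes "u \<in> pverts G" "v \<in> pverts G"
  shows "gdist G u v \<le> 2 \<longleftrightarrow>
    u = v \<or> (u, v) \<in> parcs G \<or> (\<exists>w. (u, w) \<in> parcs G \<and> (w, v) \<in> parcs G)"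
    (is "_ \<longleftrightarrow> ?near")
proof
  assume "gdist G u v \<le> 2"
  then obtain p where p: "awalk u p v" "length p \<le> 2"
    using gdist_le_iff_apath[of G u v 2] by (auto simp: numeral_eq_enat apath_def)
  then consider "p = []" | e where "p = [e]" | e f where "p = [e, f]"
    by (cases p; cases "tl p") auto
  then show ?near
    using p(1) by cases (auto simp: awalk_simps)
next
  assume near: ?near
  show "gdist G u v \<le> 2"
  proof (cases "u = v \<or> (u, v) \<in> parcs G")
    case True
    then have "gdist G u v \<le> 1"
      using gdist_le_one_iff[OF assms] by simp
    also have "(1::enat) \<le> 2" by simp
    finally show ?thesis .
  next
    case False
    with near obtain w where w: "(u, w) \<in> parcs G" "(w, v) \<in> parcs G" by blast
    with False have "w \<noteq> u" "w \<noteq> v" "u \<noteq> v" by auto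
    with w assms in_arcsD2[OF w(1)] have "apath u [(u, w), (w, v)] v"
      by (auto simp: apath_def awalk_simps)
    then have "\<exists>p. apath u p v \<and> length p \<le> 2"
      by (intro exI[of _ "[(u, w), (w, v)]"]) simp
    then show ?thesis
      using gdist_le_iff_apath[of G u v 2] by (simp add: numeral_eq_enat)
  qed
qed

lemma gdist_eq_two_iff:
  assumes "u \<in> pverts G" "v \<in> pverts G"
  shows "gdist G u v = 2 \<longleftrightarrow>
    u \<noteq> v \<and> (u, v) \<notin> parcs G \<and> (\<exists>w. (u, w) \<in> parcs G \<and> (w, v) \<in> parcs G)"
proof -
  have "d = 2 \<longleftrightarrow> d \<le> 2 \<and> \<not> d \<le> 1" for d :: enat
    by (cases d) (auto simp: numeral_eq_enat one_enat_def)
  then show ?thesis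
    using gdist_le_one_iff[OF assms] gdist_le_two_iff[OF assms] by metis
qed

end

section \<open>Common non-neighbours\<close>

definition edges_have_common_nonneighbour :: "'a pair_pre_digraph \<Rightarrow> bool" where
  "edges_have_common_nonneighbour G \<longleftrightarrow>
     (\<forall>v1 v2. (v1, v2) \<in> parcs G \<longrightarrow>
        (\<exists>v3\<in>pverts G. (v1, v3) \<notin> parcs G \<and> (v2, v3) \<notin> parcs G))"

text \<open>
  Adjacency in the complement also requires the vertices to differ. That is automatic here, because
  each end of the edge is a neighbour of the other end and so is no common non-neighbour.
\<close>

lemma (in pair_graph) common_nonneighbour_iff_compl:
  assumes "(u, v) \<in> parcs G"
  shows "(\<exists>w\<in>pverts G. (u, w) \<notin> parcs G \<and> (v, w) \<notin> parcs G) \<longleftrightarrow>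
    (\<exists>w. (u, w) \<in> parcs (graph_compl G) \<and> (w, v) \<in> parcs (graph_compl G))"
proof -
  have "(x, y) \<in> parcs G \<longleftrightarrow> (y, x) \<in> parcs G" for x y
    using arcs_symmetric by blast
  moreover have "u \<in> pverts G" "v \<in> pverts G"
    using in_arcsD1[OF assms] in_arcsD2[OF assms] by simp_all
  ultimately show ?thesis
    using assms unfolding graph_compl_def by simp metis
qed

lemma (in pair_graph) edges_have_common_nonneighbour_iff_gdiam_compl:
  "edges_have_common_nonneighbour G \<longleftrightarrow> gdiam (with_proj (graph_compl G)) \<le> 2"
proof -
  let ?C = "graph_compl G"
  have "pair_graph G" by unfold_locales
  then interpret C: pair_graph ?C by (rule pair_graph_graph_compl)
  have verts: "pverts ?C = pverts G" by (simp add: graph_compl_def)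
  have near: "gdist ?C u v \<le> 2 \<longleftrightarrow> ((u, v) \<in> parcs G \<longrightarrow>
      (\<exists>w\<in>pverts G. (u, w) \<notin> parcs G \<and> (v, w) \<notin> parcs G))"
    if uv: "u \<in> pverts G" "v \<in> pverts G" for u v
  proof (cases "(u, v) \<in> parcs G")
    case True
    have "u \<noteq> v" "(u, v) \<notin> parcs ?C"
      using True by (auto simp: graph_compl_def dest: pair_no_loops)
    with True show ?thesis
      using C.gdist_le_two_iff[of u v] common_nonneighbour_iff_compl[OF True] uv verts by simp
  next
    case False
    then have "u = v \<or> (u, v) \<in> parcs ?C"
      using uv by (auto simp: graph_compl_def)
    with False show ?thesis
      using C.gdist_le_two_iff[of u v] uv verts by auto
  qed
  have "gdiam ?C \<le> 2 \<longleftrightarrow> (\<forall>u\<in>pverts G. \<forall>v\<in>pverts G. gdist ?C u v \<le> 2)"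
    by (auto simp: gdiam_def SUP_le_iff verts)
  also have "\<dots> \<longleftrightarrow> edges_have_common_nonneighbour G"
  proof -
    have "u \<in> pverts G \<and> v \<in> pverts G" if "(u, v) \<in> parcs G" for u v
      using in_arcsD1[OF that] in_arcsD2[OF that] by simp
    then show ?thesis
      unfolding edges_have_common_nonneighbour_def using near by blast
  qed
  finally show ?thesis by simp
qed

section \<open>Recognising 2-distance graphs\<close>

text \<open>
  Pairs at distance 2 in the complement are always edges of \<open>G\<close>; the assumption supplies the
  midpoints that make every edge such a pair.
\<close>

lemma (in pair_graph) T2_graph_compl:
  assumes "edges_have_common_nonneighbour G"
  shows "T2 (graph_compl G) = G"
proof -
  let ?C = "graph_compl G"
  have "pair_graph G" by unfold_locales
  then interpret C: pair_graph ?C by (rule pair_graph_graph_compl)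
  have verts: "pverts ?C = pverts G" by (simp add: graph_compl_def)
  have "gdist ?C u v = 2 \<longleftrightarrow> (u, v) \<in> parcs G" if uv: "u \<in> pverts G" "v \<in> pverts G" for u v
  proof -
    have "u \<noteq> v \<and> (u, v) \<notin> parcs ?C \<longleftrightarrow> (u, v) \<in> parcs G"
      using uv by (auto simp: graph_compl_def dest: pair_no_loops)
    moreover have "\<exists>w. (u, w) \<in> parcs ?C \<and> (w, v) \<in> parcs ?C" if "(u, v) \<in> parcs G"
      using assms that common_nonneighbour_iff_compl[OF that]
      unfolding edges_have_common_nonneighbour_def by blast
    ultimately show ?thesis
      using C.gdist_eq_two_iff[of u v] uv verts by auto
  qed
  then have "parcs (T2 ?C) = parcs G"
    using in_arcsD1 in_arcsD2 by (auto simp: T2_def verts)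
  then show ?thesis
    by (simp add: T2_def verts)
qed

text \<open>
  Two vertices at distance 2 have a common neighbour; it is at distance 1 from each of them, hence
  adjacent to neither in the 2-distance graph.
\<close>

lemma (in pair_graph) edges_have_common_nonneighbour_T2:
  "edges_have_common_nonneighbour (T2 G)"
  unfolding edges_have_common_nonneighbour_def
proof (intro allI impI)
  fix u v assume "(u, v) \<in> parcs (T2 G)"
  then have uv: "u \<in> pverts G" "v \<in> pverts G" "gdist G u v = 2"
    by (auto simp: T2_def)
  then obtain w where w: "(u, w) \<in> parcs G" "(w, v) \<in> parcs G"
    using gdist_eq_two_iff by blast
  have "w \<in> pverts G" using in_arcsD2[OF w(1)] by simp
  moreover have "(v, w) \<in> parcs G" using w(2) by (rule arcs_symmetric)
  ultimately have "gdist G u w \<noteq> 2" "gdist G v w \<noteq> 2"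
    using uv w gdist_eq_two_iff by blast+
  with \<open>w \<in> pverts G\<close> show "\<exists>w\<in>pverts (T2 G). (u, w) \<notin> parcs (T2 G) \<and> (v, w) \<notin> parcs (T2 G)"
    by (auto simp: T2_def)
qed

lemma (in wf_digraph) digraph_iso_refl: "digraph_iso G G"
  unfolding digraph_iso_def
proof (intro exI conjI)
  let ?id = "\<lparr> iso_verts = id, iso_arcs = id, iso_head = head G, iso_tail = tail G \<rparr>"
  show "digraph_isomorphism ?id"
    by (simp add: digraph_isomorphism_def wf_digraph_axioms)
  show "G = app_iso ?id G"
    by (simp add: app_iso_def)
qed

text \<open>
  An isomorphism of digraphs carries a separate map on arcs. When arcs are pairs of vertices, the
  ends of an arc determine it, so the vertex map induces the arc map.
\<close>

lemma digraph_iso_pairE: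
  assumes "pair_wf_digraph H" and "digraph_iso (with_proj H) (with_proj G)"
  obtains h where "inj_on h (pverts H)" "pverts G = h ` pverts H"
    "parcs G = map_prod h h ` parcs H"
proof -
  interpret H: pair_wf_digraph H by fact
  from assms(2) obtain f where f: "H.digraph_isomorphism f"
    and G: "with_proj G = app_iso f (with_proj H)"
    unfolding digraph_iso_def by blast
  let ?h = "iso_verts f"
  have "iso_arcs f a = map_prod ?h ?h a" if a: "a \<in> parcs H" for a
  proof -
    have "?h (fst a) = iso_tail f (iso_arcs f a)" "?h (snd a) = iso_head f (iso_arcs f a)"
      using f a by (auto simp: H.digraph_isomorphism_def)
    moreover have "iso_tail f = fst" "iso_head f = snd"
      using G by (simp_all add: with_proj_def app_iso_def)
    ultimately show ?thesis
      by (simp add: prod_eq_iff)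
  qed
  moreover have "parcs G = iso_arcs f ` parcs H" "pverts G = ?h ` pverts H"
    using G by (simp_all add: with_proj_def app_iso_def)
  moreover have "inj_on ?h (pverts H)"
    using H.digraph_isomorphism_inj_on_verts[OF f] by simp
  ultimately show thesis
    by (intro that[of ?h]) (auto intro!: image_cong)
qed

lemma edges_have_common_nonneighbour_iso:
  assumes "pair_wf_digraph H" and "digraph_iso (with_proj H) (with_proj G)"
    and H: "edges_have_common_nonneighbour H"
  shows "edges_have_common_nonneighbour G"
proof -
  interpret H: pair_wf_digraph H by fact
  obtain h where h: "inj_on h (pverts H)" "pverts G = h ` pverts H"
      "parcs G = map_prod h h ` parcs H"
    using assms(1,2) by (rule digraph_iso_pairE)
  have arcs: "x \<in> pverts H" "y \<in> pverts H" if "(x, y) \<in> parcs H" for x y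
    using H.in_arcsD1[OF that] H.in_arcsD2[OF that] by simp_all
  have reflect: "(x, y) \<in> parcs H"
    if hxy: "(h x, h y) \<in> parcs G" and xy: "x \<in> pverts H" "y \<in> pverts H" for x y
  proof -
    obtain x' y' where *: "(x', y') \<in> parcs H" "h x = h x'" "h y = h y'"
      using hxy unfolding h(3) by auto
    with xy arcs[OF *(1)] have "x = x'" "y = y'"
      using h(1) by (auto dest: inj_onD)
    with *(1) show ?thesis by simp
  qed
  show ?thesis
    unfolding edges_have_common_nonneighbour_def
  proof (intro allI impI)
    fix v1 v2 assume "(v1, v2) \<in> parcs G"
    then obtain x y where xy: "(x, y) \<in> parcs H" "v1 = h x" "v2 = h y"
      unfolding h(3) by auto
    with H obtain z where "z \<in> pverts H" "(x, z) \<notin> parcs H" "(y, z) \<notin> parcs H"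
      unfolding edges_have_common_nonneighbour_def by blast
    then show "\<exists>v3\<in>pverts G. (v1, v3) \<notin> parcs G \<and> (v2, v3) \<notin> parcs G"
      using reflect arcs[OF xy(1)] xy(2,3) unfolding h(2) by blast
  qed
qed

lemma (in pair_graph) two_distance_graph_iff_edges_have_common_nonneighbour:
  "two_distance_graph G \<longleftrightarrow> edges_have_common_nonneighbour G"
proof
  assume "two_distance_graph G"
  then obtain X :: "'a pair_pre_digraph"
    where X: "pair_graph X" and iso: "digraph_iso (with_proj (T2 X)) (with_proj G)"
    unfolding two_distance_graph_def by blast
  interpret T: pair_graph "T2 X" using X by (rule pair_graph_T2)
  show "edges_have_common_nonneighbour G"
    using T.pair_wf_digraph_axioms iso pair_graph.edges_have_common_nonneighbour_T2[OF X]
    by (rule edges_have_common_nonneighbour_iso)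
next
  assume "edges_have_common_nonneighbour G"
  then have "T2 (graph_compl G) = G" by (rule T2_graph_compl)
  moreover have "pair_graph (graph_compl G)"
    by (rule pair_graph_graph_compl) unfold_locales
  ultimately show "two_distance_graph G"
    unfolding two_distance_graph_def using digraph_iso_refl by auto
qed

theorem theorem2p1:
  fixes G :: "'a pair_pre_digraph"
  assumes "pair_graph G"
  shows "(two_distance_graph G \<longleftrightarrow>
            (\<forall>v1 v2. (v1, v2) \<in> parcs G \<longrightarrow>
               (\<exists>v3\<in>pverts G. (v1, v3) \<notin> parcs G \<and> (v2, v3) \<notin> parcs G)))
       \<and> ((\<forall>v1 v2. (v1, v2) \<in> parcs G \<longrightarrow>
               (\<exists>v3\<in>pverts G. (v1, v3) \<notin> parcs G \<and> (v2, v3) \<notin> parcs G)) \<longleftrightarrow>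
            gdiam (with_proj (graph_compl G)) \<le> 2)"
proof -
  interpret pair_graph G by fact
  show ?thesis
    using two_distance_graph_iff_edges_have_common_nonneighbour
      edges_have_common_nonneighbour_iff_gdiam_compl
    unfolding edges_have_common_nonneighbour_def by blast
qed

end
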